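(* Let $d,n$ be positive integers, let $K$ be a field of characteristic zero, and let $I\in\mathcal{A}_d(n)$ be an Artinian monomial ideal in $K[x_1,\dots,x_d]$. Then $I$ is strongly stable if and only if $\varphi(I)$ is a strongly stable partition.
   Context: Let $\mathbb{N}=\{0,1,2,\dots\}$ and, for $\alpha=(a_1,\dots,a_d)\in\mathbb{N}^d$, write $\mathbf{x}^\alpha=x_1^{a_1}\cdots x_d^{a_d}$. For a monomial ideal $I$, $G(I)$ denotes its unique minimal set of monomial generators. A pure power of $x_j$ is a monomial $x_j^k$. A monomial ideal is Artinian if the quotient ring has Krull dimension zero, equivalently it contains a pure power of each $x_j$. $\mathcal{A}_d(n)$ is the set of Artinian monomial ideals for which the largest degree of any pure power in $G(I)$ equals $n$. For $I\in\mathcal{A}_d(n)$, $\varphi(I)=\{\alpha\in\mathbb{N}^d\mid \mathbf{x}^\alpha\notin I\}$. A monomial ideal $I$ is strongly stable if $m\frac{x_i}{x_j}\in I$ for all monomials $m\in I$ and all $i<j$ with $x_j\mid m$. A $d$-dimensional partition is a finite subset $P\subset\mathbb{N}^d$ such that $(a_1,\dots,a_j,\dots,a_d)\in P$ implies $(a_1,\dots,a_j-1,\dots,a_d)\in P$ for all $j$ with $a_j>0$; its elements are called cells. For a cell $\alpha\in P$, the $j$th arm length $h_j$ is the largest integer such that $(a_1,\dots,a_j+h_j,\dots,a_d)\in P$, and $H(\alpha)=(h_1,\dots,h_d)$ is its Hook vector. A strongly stable partition is a partition for which every cell's Hook vector is weakly increasing ($h_1\le\cdots\le h_d$). *)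

theory Defs
  imports
    "HOL-Algebra.QuotRing"
    "HOL-Library.Poly_Mapping"
    "HOL-Library.Extended_Real"
begin

text \<open>
  The variables are indexed by \<open>1, \<dots>, d\<close>. An exponent vector is a finitely supported function
  \<open>nat \<Rightarrow>\<^sub>0 nat\<close> whose support lies in \<open>{1..d}\<close>, and a polynomial is a finitely supported
  function from exponent vectors to coefficients; the product of \<open>HOL-Library.Poly_Mapping\<close>
  is the convolution product, i.e. the product of polynomials.
\<close>

definition expvecs :: "nat \<Rightarrow> (nat \<Rightarrow>\<^sub>0 nat) set" where
  "expvecs d = {\<alpha>. Poly_Mapping.keys \<alpha> \<subseteq> {1..d}}"

definition mpoly_ring :: "nat \<Rightarrow> ((nat \<Rightarrow>\<^sub>0 nat) \<Rightarrow>\<^sub>0 'k::field) ring" where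
  "mpoly_ring d =
     \<lparr>carrier = {p. Poly_Mapping.keys p \<subseteq> expvecs d}, mult = (*), one = 1, zero = 0, add = (+)\<rparr>"

definition monomial :: "(nat \<Rightarrow>\<^sub>0 nat) \<Rightarrow> (nat \<Rightarrow>\<^sub>0 nat) \<Rightarrow>\<^sub>0 'k::field" where
  "monomial \<alpha> = Poly_Mapping.single \<alpha> 1"

definition unit_vec :: "nat \<Rightarrow> nat \<Rightarrow>\<^sub>0 nat" where
  "unit_vec j = Poly_Mapping.single j 1"

definition pure_power :: "nat \<Rightarrow> nat \<Rightarrow> (nat \<Rightarrow>\<^sub>0 nat) \<Rightarrow>\<^sub>0 'k::field" where
  "pure_power j k = monomial (unit_vec j) ^ k"


definition monomial_gens ::
    "nat \<Rightarrow> ((nat \<Rightarrow>\<^sub>0 nat) \<Rightarrow>\<^sub>0 'k::field) set \<Rightarrow> ((nat \<Rightarrow>\<^sub>0 nat) \<Rightarrow>\<^sub>0 'k) set \<Rightarrow> bool" where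
  "monomial_gens d I S \<longleftrightarrow> S \<subseteq> monomial ` expvecs d \<and> I = Idl\<^bsub>mpoly_ring d\<^esub> S"

definition monomial_ideal :: "nat \<Rightarrow> ((nat \<Rightarrow>\<^sub>0 nat) \<Rightarrow>\<^sub>0 'k::field) set \<Rightarrow> bool" where
  "monomial_ideal d I \<longleftrightarrow> (\<exists>S. monomial_gens d I S)"

text \<open>
  The set \<open>G(I)\<close>. For a monomial ideal there is exactly one inclusion-minimal set of monomial
  generators.
\<close>
definition min_gens ::
    "nat \<Rightarrow> ((nat \<Rightarrow>\<^sub>0 nat) \<Rightarrow>\<^sub>0 'k::field) set \<Rightarrow> ((nat \<Rightarrow>\<^sub>0 nat) \<Rightarrow>\<^sub>0 'k) set" where
  "min_gens d I = (THE S. monomial_gens d I S \<and> (\<forall>T. T \<subset> S \<longrightarrow> \<not> monomial_gens d I T))"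

text \<open>
  The supremum of the lengths of chains \<open>P\<^sub>0 \<subset> \<dots> \<subset> P\<^sub>l\<close> of prime ideals; a chain of
  length \<open>l\<close> has \<open>l + 1\<close> members. The zero ring gets dimension \<open>-\<infinity>\<close>.
\<close>
definition krull_dim :: "('a, 'b) ring_scheme \<Rightarrow> ereal" where
  "krull_dim R =
     (SUP C \<in> {C. subset.chain {P. primeideal P R} C \<and> finite C \<and> C \<noteq> {}}.
        ereal (real (card C) - 1))"

definition artinian_monomial_ideal :: "nat \<Rightarrow> ((nat \<Rightarrow>\<^sub>0 nat) \<Rightarrow>\<^sub>0 'k::field) set \<Rightarrow> bool" where
  "artinian_monomial_ideal d I \<longleftrightarrow> monomial_ideal d I \<and> krull_dim (mpoly_ring d Quot I) = 0"

text \<open>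
  The set \<open>A\<^sub>d(n)\<close>: the exponent \<open>n\<close> is attained by a pure power in \<open>G(I)\<close> and bounds all of them.
\<close>
definition artinian_class :: "nat \<Rightarrow> nat \<Rightarrow> ((nat \<Rightarrow>\<^sub>0 nat) \<Rightarrow>\<^sub>0 'k::field) set set" where
  "artinian_class d n = {I. artinian_monomial_ideal d I \<and>
     (\<exists>j\<in>{1..d}. pure_power j n \<in> min_gens d I) \<and>
     (\<forall>j\<in>{1..d}. \<forall>k. pure_power j k \<in> min_gens d I \<longrightarrow> k \<le> n)}"

text \<open>
  When \<open>x\<^sub>j\<close> divides \<open>x\<^sup>\<alpha>\<close>, i.e. \<open>\<alpha>\<^sub>j > 0\<close>, the truncated difference \<open>\<alpha> - unit_vec j\<close> is the
  exponent vector of \<open>x\<^sup>\<alpha> / x\<^sub>j\<close>.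
\<close>
definition strongly_stable :: "nat \<Rightarrow> ((nat \<Rightarrow>\<^sub>0 nat) \<Rightarrow>\<^sub>0 'k::field) set \<Rightarrow> bool" where
  "strongly_stable d I \<longleftrightarrow>
     (\<forall>\<alpha>\<in>expvecs d. monomial \<alpha> \<in> I \<longrightarrow>
        (\<forall>i\<in>{1..d}. \<forall>j\<in>{1..d}. i < j \<and> Poly_Mapping.lookup \<alpha> j > 0 \<longrightarrow>
           monomial (\<alpha> - unit_vec j + unit_vec i) \<in> I))"

definition phi :: "nat \<Rightarrow> ((nat \<Rightarrow>\<^sub>0 nat) \<Rightarrow>\<^sub>0 'k::field) set \<Rightarrow> (nat \<Rightarrow>\<^sub>0 nat) set" where
  "phi d I = {\<alpha>\<in>expvecs d. monomial \<alpha> \<notin> I}"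


definition is_partition :: "nat \<Rightarrow> (nat \<Rightarrow>\<^sub>0 nat) set \<Rightarrow> bool" where
  "is_partition d P \<longleftrightarrow> finite P \<and> P \<subseteq> expvecs d \<and>
     (\<forall>\<alpha>\<in>P. \<forall>j\<in>{1..d}. Poly_Mapping.lookup \<alpha> j > 0 \<longrightarrow> \<alpha> - unit_vec j \<in> P)"

definition arm_length :: "(nat \<Rightarrow>\<^sub>0 nat) set \<Rightarrow> (nat \<Rightarrow>\<^sub>0 nat) \<Rightarrow> nat \<Rightarrow> nat" where
  "arm_length P \<alpha> j = (GREATEST h. \<alpha> + Poly_Mapping.single j h \<in> P)"

definition hook_vector :: "nat \<Rightarrow> (nat \<Rightarrow>\<^sub>0 nat) set \<Rightarrow> (nat \<Rightarrow>\<^sub>0 nat) \<Rightarrow> nat list" where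
  "hook_vector d P \<alpha> = map (arm_length P \<alpha>) [1..<Suc d]"

definition strongly_stable_partition :: "nat \<Rightarrow> (nat \<Rightarrow>\<^sub>0 nat) set \<Rightarrow> bool" where
  "strongly_stable_partition d P \<longleftrightarrow> is_partition d P \<and> (\<forall>\<alpha>\<in>P. sorted (hook_vector d P \<alpha>))"


lemma zero_in_expvecs [simp]: "0 \<in> expvecs d"
  by (simp add: expvecs_def)

lemma expvecs_add: "\<alpha> \<in> expvecs d \<Longrightarrow> \<beta> \<in> expvecs d \<Longrightarrow> \<alpha> + \<beta> \<in> expvecs d"
  using Poly_Mapping.keys_add[of \<alpha> \<beta>] by (auto simp: expvecs_def)

lemma cring_mpoly_ring: "cring (mpoly_ring d :: ((nat \<Rightarrow>\<^sub>0 nat) \<Rightarrow>\<^sub>0 'k::field) ring)"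
proof (rule cringI)
  let ?R = "mpoly_ring d :: ((nat \<Rightarrow>\<^sub>0 nat) \<Rightarrow>\<^sub>0 'k) ring"
  have add: "p + q \<in> carrier ?R" if "p \<in> carrier ?R" "q \<in> carrier ?R" for p q
    using that Poly_Mapping.keys_add[of p q] by (auto simp: mpoly_ring_def)
  have mult: "p * q \<in> carrier ?R" if "p \<in> carrier ?R" "q \<in> carrier ?R" for p q
    using that Poly_Mapping.keys_mult[of p q] by (fastforce simp: mpoly_ring_def intro: expvecs_add)
  show "abelian_group ?R"
  proof (rule abelian_groupI)
    fix p assume "p \<in> carrier ?R"
    then show "\<exists>q\<in>carrier ?R. q \<oplus>\<^bsub>?R\<^esub> p = \<zero>\<^bsub>?R\<^esub>"
      by (intro bexI[of _ "- p"]) (auto simp: mpoly_ring_def)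
  qed (use add in \<open>auto simp: mpoly_ring_def algebra_simps\<close>)
  show "comm_monoid ?R"
    by (rule comm_monoidI) (use mult in \<open>auto simp: mpoly_ring_def algebra_simps\<close>)
qed (auto simp: mpoly_ring_def algebra_simps)

end

theory Submission
  imports Defs
begin

text \<open>
  Dimension zero makes \<open>\<phi>(I)\<close> finite: if \<open>I\<close> contained no power of \<open>x\<^sub>j\<close>, then the prime ideals
  \<open>(x\<^sub>i | i \<noteq> j) \<subset> (x\<^sub>1, \<dots>, x\<^sub>d)\<close> would both contain \<open>I\<close> and give a chain of length one in the quotient.
  On the complement \<open>P\<close> of \<open>I\<close>, strong stability says that \<open>\<alpha> \<in> P\<close>, \<open>\<alpha>\<^sub>i > 0\<close> and \<open>i < j\<close> imply
  \<open>\<alpha> - e\<^sub>i + e\<^sub>j \<in> P\<close>. Moving the \<open>i\<close>th arm of a cell unit by unit to direction \<open>j\<close> shows \<open>h\<^sub>i \<le> h\<^sub>j\<close>;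
  conversely the cell \<open>\<alpha> - e\<^sub>i\<close> has \<open>h\<^sub>i \<ge> 1\<close>, so \<open>h\<^sub>j \<ge> 1\<close>.
\<close>

section \<open>Prime ideals generated by variables\<close>

text \<open>This is the ideal generated by the variables of \<open>{1..d}\<close> outside
  \<open>J\<close>, encoded by supports so that membership can be read off term by term. Only
  \<open>J = {j}\<close> and \<open>J = {}\<close> occur in the dimension argument.\<close>

definition coordinate_ideal :: "nat \<Rightarrow> nat set \<Rightarrow> ((nat \<Rightarrow>\<^sub>0 nat) \<Rightarrow>\<^sub>0 'k::field) set" where
  "coordinate_ideal d J =
     {p \<in> carrier (mpoly_ring d). \<forall>\<alpha>\<in>Poly_Mapping.keys p. \<not> Poly_Mapping.keys \<alpha> \<subseteq> J}"

lemma keys_add_nat: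
  fixes \<alpha> \<beta> :: "'a \<Rightarrow>\<^sub>0 nat"
  shows "Poly_Mapping.keys (\<alpha> + \<beta>) = Poly_Mapping.keys \<alpha> \<union> Poly_Mapping.keys \<beta>"
  by (auto simp: lookup_add in_keys_iff)

lemma poly_mapping_split:
  fixes p :: "'a \<Rightarrow>\<^sub>0 'b::comm_monoid_add"
  obtains q r where "p = q + r" "Poly_Mapping.keys q \<subseteq> A" "Poly_Mapping.keys r \<inter> A = {}"
proof -
  define part where
    "part B = (\<Sum>\<alpha>\<in>Poly_Mapping.keys p \<inter> B. Poly_Mapping.single \<alpha> (Poly_Mapping.lookup p \<alpha>))" for B
  have part: "Poly_Mapping.lookup (part B) \<alpha> = (if \<alpha> \<in> B then Poly_Mapping.lookup p \<alpha> else 0)"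
    for B \<alpha>
    by (auto simp: part_def lookup_sum lookup_single when_def in_keys_iff)
  show thesis
  proof (rule that[of "part A" "part (- A)"])
    show "p = part A + part (- A)"
      by (rule poly_mapping_eqI) (simp add: lookup_add part)
  qed (auto simp: in_keys_iff part split: if_splits)
qed

text \<open>Exponents cannot cancel in a sum, so a variable outside \<open>J\<close> in one factor
  survives in every term of a product.\<close>

lemma ideal_coordinate_ideal:
  "ideal (coordinate_ideal d J) (mpoly_ring d :: ((nat \<Rightarrow>\<^sub>0 nat) \<Rightarrow>\<^sub>0 'k::field) ring)"
proof -
  let ?R = "mpoly_ring d :: ((nat \<Rightarrow>\<^sub>0 nat) \<Rightarrow>\<^sub>0 'k) ring"
  let ?C = "coordinate_ideal d J :: ((nat \<Rightarrow>\<^sub>0 nat) \<Rightarrow>\<^sub>0 'k) set"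
  interpret cring ?R by (rule cring_mpoly_ring)
  \<comment> \<open>The additive inverse of the ring record is given abstractly; identifying it with
    \<open>- p\<close> makes its support visible.\<close>
  have neg: "\<ominus>\<^bsub>?R\<^esub> p = - p" if "p \<in> carrier ?R" for p
    by (rule minus_equality) (use that in \<open>auto simp: mpoly_ring_def\<close>)
  have mult: "p * q \<in> ?C" if "p \<in> ?C" "q \<in> carrier ?R" for p q
  proof -
    have "p * q \<in> carrier ?R"
      using that m_closed[of p q] by (simp add: mpoly_ring_def coordinate_ideal_def)
    then show ?thesis
      using that Poly_Mapping.keys_mult[of p q]
      by (fastforce simp: coordinate_ideal_def keys_add_nat)
  qed
  show ?thesis
  proof (rule idealI)
    show "ring ?R" by (rule ring_axioms)
    show "subgroup ?C (add_monoid ?R)"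
    proof (rule add.subgroupI)
      show "?C \<subseteq> carrier ?R"
        by (auto simp: coordinate_ideal_def)
      show "?C \<noteq> {}"
        by (auto simp: coordinate_ideal_def mpoly_ring_def intro: exI[of _ 0])
      fix p q assume pq: "p \<in> ?C" "q \<in> ?C"
      then show "\<ominus>\<^bsub>?R\<^esub> p \<in> ?C"
        by (auto simp: neg coordinate_ideal_def) (auto simp: mpoly_ring_def)
      have "p + q \<in> carrier ?R"
        using pq a_closed[of p q] by (simp add: mpoly_ring_def coordinate_ideal_def)
      then show "p \<oplus>\<^bsub>?R\<^esub> q \<in> ?C"
        using pq Poly_Mapping.keys_add[of p q]
        by (auto simp: coordinate_ideal_def) (auto simp: mpoly_ring_def)
    qed
  qed (use mult in \<open>auto simp: mpoly_ring_def mult.commute\<close>)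
qed

text \<open>The quotient is in essence the polynomial ring in the variables from \<open>J\<close>, a
  domain. Concretely, a polynomial is congruent to its part \<open>p1\<close> in these variables,
  and a product in the ideal forces \<open>p1 * q1 = 0\<close>.\<close>

lemma primeideal_coordinate_ideal:
  "primeideal (coordinate_ideal d J) (mpoly_ring d :: ((nat \<Rightarrow>\<^sub>0 nat) \<Rightarrow>\<^sub>0 'k::field) ring)"
proof (rule primeidealI)
  let ?R = "mpoly_ring d :: ((nat \<Rightarrow>\<^sub>0 nat) \<Rightarrow>\<^sub>0 'k) ring"
  let ?C = "coordinate_ideal d J :: ((nat \<Rightarrow>\<^sub>0 nat) \<Rightarrow>\<^sub>0 'k) set"
  show "ideal ?C ?R" by (rule ideal_coordinate_ideal)
  show "cring ?R" by (rule cring_mpoly_ring)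
  have "1 \<in> carrier ?R" "1 \<notin> ?C"
    by (auto simp: mpoly_ring_def coordinate_ideal_def)
  then show "carrier ?R \<noteq> ?C" by blast
  fix p q assume p: "p \<in> carrier ?R" and q: "q \<in> carrier ?R" and pq: "p \<otimes>\<^bsub>?R\<^esub> q \<in> ?C"
  let ?A = "{\<alpha> :: nat \<Rightarrow>\<^sub>0 nat. Poly_Mapping.keys \<alpha> \<subseteq> J}"
  obtain p1 p2 where p12: "p = p1 + p2" "Poly_Mapping.keys p1 \<subseteq> ?A" "Poly_Mapping.keys p2 \<inter> ?A = {}"
    by (rule poly_mapping_split)
  obtain q1 q2 where q12: "q = q1 + q2" "Poly_Mapping.keys q1 \<subseteq> ?A" "Poly_Mapping.keys q2 \<inter> ?A = {}"
    by (rule poly_mapping_split)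
  have "p1 * q1 = 0"
  proof (rule ccontr)
    assume "p1 * q1 \<noteq> 0"
    then obtain \<alpha> where \<alpha>: "\<alpha> \<in> Poly_Mapping.keys (p1 * q1)" by fastforce
    then have A: "Poly_Mapping.keys \<alpha> \<subseteq> J"
      using Poly_Mapping.keys_mult[of p1 q1] p12(2) q12(2) by (fastforce simp: keys_add_nat)
    have outside: "\<alpha> \<notin> Poly_Mapping.keys (r * s)"
      if "Poly_Mapping.keys r \<inter> ?A = {}" for r s :: "(nat \<Rightarrow>\<^sub>0 nat) \<Rightarrow>\<^sub>0 'k"
    proof
      assume "\<alpha> \<in> Poly_Mapping.keys (r * s)"
      then obtain \<beta> \<gamma> where "\<beta> \<in> Poly_Mapping.keys r" "\<alpha> = \<beta> + \<gamma>"
        using Poly_Mapping.keys_mult[of r s] by blast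
      then show False using A that by (auto simp: keys_add_nat)
    qed
    \<comment> \<open>All other contributions to \<open>p * q\<close> have a factor whose terms each
      involve a variable outside \<open>J\<close>, so the coefficient at \<open>\<alpha>\<close>
      comes from \<open>p1 * q1\<close> alone.\<close>
    have "\<alpha> \<notin> Poly_Mapping.keys (p1 * q2)" "\<alpha> \<notin> Poly_Mapping.keys (p2 * q)"
      using outside[OF q12(3), of p1] outside[OF p12(3), of q] by (simp_all add: mult.commute)
    moreover have "p * q = p1 * q1 + p1 * q2 + p2 * q"
      by (simp add: p12(1) q12(1) algebra_simps)
    ultimately have "\<alpha> \<in> Poly_Mapping.keys (p * q)"
      using \<alpha> by (simp add: in_keys_iff lookup_add)
    then show False
      using pq A by (auto simp: coordinate_ideal_def mpoly_ring_def)
  qed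
  \<comment> \<open>Polynomials over a field have no zero divisors, so \<open>p1 = 0\<close> or
    \<open>q1 = 0\<close>.\<close>
  then consider "p = p2" | "q = q2"
    using p12(1) q12(1) by auto
  then show "p \<in> ?C \<or> q \<in> ?C"
    using p q p12(3) q12(3) by cases (auto simp: coordinate_ideal_def)
qed

section \<open>Prime ideals of a quotient\<close>

text \<open>Because \<open>P\<close> contains \<open>I\<close>, it is a union of cosets of
  \<open>I\<close>, so its image in the quotient loses no information.\<close>

lemma (in cring) quot_mem_iff:
  assumes "ideal I R" "ideal P R" "I \<subseteq> P" "a \<in> carrier R"
  shows "I +> a \<in> (+>) I ` P \<longleftrightarrow> a \<in> P"
proof -
  have "P = (\<Union>j\<in>P. I +> j)"
    using assms ideal_incl_iff by blast
  moreover have "(+>) I ` P \<subseteq> carrier (R Quot I)"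
    using ideal.Icarr[OF assms(2)] by (auto simp: FactRing_def A_RCOSETS_def')
  ultimately show ?thesis
    using canonical_proj_vimage_mem_iff[OF assms(1) _ assms(4), of "(+>) I ` P"] by simp
qed

text \<open>Half of the correspondence theorem: properness and the prime condition are tested on
  representatives in \<open>R\<close>.\<close>

lemma (in cring) primeideal_quot:
  assumes I: "ideal I R" and P: "primeideal P R" and IP: "I \<subseteq> P"
  shows "primeideal ((+>) I ` P) (R Quot I)"
proof (rule primeidealI)
  interpret I: ideal I R by fact
  interpret P: primeideal P R by fact
  note mem = quot_mem_iff[OF I P.is_ideal IP]
  have carr: "carrier (R Quot I) = (+>) I ` carrier R"
    by (auto simp: FactRing_def A_RCOSETS_def')
  show "ideal ((+>) I ` P) (R Quot I)"
    by (rule ring_ideal_imp_quot_ideal[OF I P.is_ideal])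
  show "cring (R Quot I)"
    by (rule I.quotient_is_cring[OF is_cring])
  have "\<one> \<notin> P" using P.I_notcarr P.one_imp_carrier by blast
  then show "carrier (R Quot I) \<noteq> (+>) I ` P"
    using mem[of \<one>] carr by blast
  fix a b assume "a \<in> carrier (R Quot I)" "b \<in> carrier (R Quot I)"
    and ab: "a \<otimes>\<^bsub>R Quot I\<^esub> b \<in> (+>) I ` P"
  then obtain x y where xy: "x \<in> carrier R" "y \<in> carrier R" "a = I +> x" "b = I +> y"
    unfolding carr by blast
  then have "I +> (x \<otimes> y) \<in> (+>) I ` P"
    using ab by (simp add: FactRing_def I.rcoset_mult_add)
  then show "a \<in> (+>) I ` P \<or> b \<in> (+>) I ` P"
    using xy mem P.I_prime by auto
qed

text \<open>An element of \<open>Q\<close> outside \<open>P\<close> has a coset that separates the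
  two images, so they form a chain of two primes in the quotient.\<close>

lemma krull_dim_quot_pos:
  fixes R (structure)
  assumes R: "cring R" and I: "ideal I R"
    and P: "primeideal P R" and Q: "primeideal Q R" and IP: "I \<subseteq> P" and PQ: "P \<subset> Q"
  shows "krull_dim (R Quot I) \<ge> 1"
proof -
  interpret cring R by fact
  let ?p = "(+>) I ` P" and ?q = "(+>) I ` Q"
  have IQ: "I \<subseteq> Q" using IP PQ by blast
  obtain a where a: "a \<in> Q" "a \<notin> P" using PQ by blast
  have "a \<in> carrier R"
    using a ideal.Icarr[OF primeideal.axioms(1)[OF Q]] by blast
  then have "I +> a \<in> ?q" "I +> a \<notin> ?p"
    using a quot_mem_iff[OF I primeideal.axioms(1)[OF P] IP] by auto
  then have ne: "?p \<subset> ?q" using PQ by blast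
  have "subset.chain {P. primeideal P (R Quot I)} {?p, ?q}"
    using primeideal_quot[OF I P IP] primeideal_quot[OF I Q IQ] ne
    by (auto simp: pred_on.chain_def)
  then have "ereal (real (card {?p, ?q}) - 1) \<le> krull_dim (R Quot I)"
    unfolding krull_dim_def by (intro SUP_upper) auto
  moreover have "card {?p, ?q} = 2"
    using less_imp_neq[OF ne] by (metis card_2_iff)
  ultimately show ?thesis by (simp add: one_ereal_def)
qed

section \<open>The complement of an Artinian monomial ideal\<close>

lemma monomial_add: "monomial (\<alpha> + \<beta>) = monomial \<alpha> * (monomial \<beta> :: (nat \<Rightarrow>\<^sub>0 nat) \<Rightarrow>\<^sub>0 'k::field)"
  by (simp add: monomial_def mult_single)

lemma monomial_carrier:
  "\<alpha> \<in> expvecs d \<Longrightarrow> (monomial \<alpha> :: (nat \<Rightarrow>\<^sub>0 nat) \<Rightarrow>\<^sub>0 'k::field) \<in> carrier (mpoly_ring d)"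
  by (simp add: monomial_def mpoly_ring_def)

lemma ideal_monomial_ideal:
  assumes "monomial_ideal d (I :: ((nat \<Rightarrow>\<^sub>0 nat) \<Rightarrow>\<^sub>0 'k::field) set)"
  shows "ideal I (mpoly_ring d)"
proof -
  interpret cring "mpoly_ring d :: ((nat \<Rightarrow>\<^sub>0 nat) \<Rightarrow>\<^sub>0 'k) ring" by (rule cring_mpoly_ring)
  show ?thesis
    using assms monomial_carrier
    by (fastforce simp: monomial_ideal_def monomial_gens_def intro: genideal_ideal)
qed

lemma monomial_ideal_upward:
  assumes "ideal (I :: ((nat \<Rightarrow>\<^sub>0 nat) \<Rightarrow>\<^sub>0 'k::field) set) (mpoly_ring d)"
    and "monomial \<alpha> \<in> I" "\<beta> \<in> expvecs d"
  shows "monomial (\<alpha> + \<beta>) \<in> I"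
  using ideal.I_r_closed[OF assms(1,2) monomial_carrier[OF assms(3)]]
  by (simp add: monomial_add mpoly_ring_def)

lemma keys_subset_singletonD:
  assumes "Poly_Mapping.keys \<alpha> \<subseteq> {j}"
  shows "\<alpha> = Poly_Mapping.single j (Poly_Mapping.lookup \<alpha> j)"
  by (rule poly_mapping_eqI) (use assms in \<open>auto simp: lookup_single when_def in_keys_iff\<close>)

lemma artinian_contains_power:
  fixes I :: "((nat \<Rightarrow>\<^sub>0 nat) \<Rightarrow>\<^sub>0 'k::field) set"
  assumes I: "artinian_monomial_ideal d I" and j: "j \<in> {1..d}"
  shows "\<exists>k. monomial (Poly_Mapping.single j k) \<in> I"
proof (rule ccontr)
  assume none: "\<not> ?thesis"
  let ?R = "mpoly_ring d :: ((nat \<Rightarrow>\<^sub>0 nat) \<Rightarrow>\<^sub>0 'k) ring"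
  let ?C = "\<lambda>J. coordinate_ideal d J :: ((nat \<Rightarrow>\<^sub>0 nat) \<Rightarrow>\<^sub>0 'k) set"
  interpret cring ?R by (rule cring_mpoly_ring)
  obtain S where S: "S \<subseteq> monomial ` expvecs d" "I = Idl\<^bsub>?R\<^esub> S"
    using I by (auto simp: artinian_monomial_ideal_def monomial_ideal_def monomial_gens_def)
  have "S \<subseteq> carrier ?R" using S monomial_carrier by fastforce
  then have SI: "S \<subseteq> I" using S genideal_self by blast
  have "S \<subseteq> ?C {j}"
  proof
    fix m assume m: "m \<in> S"
    then obtain \<alpha> where \<alpha>: "\<alpha> \<in> expvecs d" "m = monomial \<alpha>" using S by blast
    \<comment> \<open>A generator supported on \<open>j\<close> alone would be a power of the
      \<open>j\<close>th variable lying in \<open>I\<close>; exponent 0 covers the generator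
      1.\<close>
    then have "\<not> Poly_Mapping.keys \<alpha> \<subseteq> {j}"
      using none m SI keys_subset_singletonD by (metis subsetD)
    then show "m \<in> ?C {j}"
      using \<alpha> monomial_carrier[of \<alpha> d] by (simp add: coordinate_ideal_def) (simp add: monomial_def)
  qed
  then have I_sub: "I \<subseteq> ?C {j}"
    using S genideal_minimal[OF ideal_coordinate_ideal] by blast
  have "Poly_Mapping.single j (Suc 0) \<noteq> 0"
    by (metis lookup_single_eq lookup_zero nat.distinct(1))
  \<comment> \<open>The \<open>j\<close>th variable itself witnesses that the inclusion of the two
    primes is strict.\<close>
  then have "monomial (unit_vec j) \<in> ?C {}" "monomial (unit_vec j) \<notin> ?C {j}"
    using j by (auto simp: coordinate_ideal_def mpoly_ring_def monomial_def unit_vec_def expvecs_def)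
  moreover have "?C {j} \<subseteq> ?C {}" by (auto simp: coordinate_ideal_def)
  ultimately have "?C {j} \<subset> ?C {}" by blast
  moreover have "ideal I ?R"
    using I ideal_monomial_ideal by (auto simp: artinian_monomial_ideal_def)
  ultimately have "krull_dim (?R Quot I) \<ge> 1"
    by (intro krull_dim_quot_pos[OF is_cring _ primeideal_coordinate_ideal
          primeideal_coordinate_ideal I_sub])
  then show False using I by (simp add: artinian_monomial_ideal_def)
qed

lemma finite_bounded_expvecs:
  "finite {\<alpha> \<in> expvecs d. \<forall>j\<in>{1..d}. Poly_Mapping.lookup \<alpha> j < k j}" (is "finite ?B")
proof (rule finite_imageD)
  \<comment> \<open>A common bound for all \<open>k j\<close>, so that every coordinate function
    maps into one finite set and is 0 outside \<open>{1..d}\<close>.\<close>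
  define N where "N = (\<Sum>j\<in>{1..d}. k j)"
  have "Poly_Mapping.lookup ` ?B \<subseteq> {f. \<forall>x. (x \<in> {1..d} \<longrightarrow> f x \<in> {..N}) \<and> (x \<notin> {1..d} \<longrightarrow> f x = 0)}"
  proof (rule image_subsetI, rule CollectI, intro allI conjI impI)
    fix \<alpha> x assume \<alpha>: "\<alpha> \<in> ?B"
    show "Poly_Mapping.lookup \<alpha> x \<in> {..N}" if "x \<in> {1..d}"
      using \<alpha> that member_le_sum[of x "{1..d}" k] by (fastforce simp: N_def)
    show "Poly_Mapping.lookup \<alpha> x = 0" if "x \<notin> {1..d}"
      using \<alpha> that by (auto simp: expvecs_def in_keys_iff)
  qed
  then show "finite (Poly_Mapping.lookup ` ?B)"
    by (rule finite_subset) (intro finite_set_of_finite_funs; simp)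
qed (auto intro: inj_onI poly_mapping_eqI)

lemma minus_single_add_single:
  "h \<le> Poly_Mapping.lookup \<alpha> j \<Longrightarrow>
    \<alpha> - Poly_Mapping.single j h + Poly_Mapping.single j h = (\<alpha> :: nat \<Rightarrow>\<^sub>0 nat)"
  by (rule poly_mapping_eqI) (auto simp: lookup_add lookup_minus lookup_single when_def)

lemma keys_minus_nat: "Poly_Mapping.keys (\<alpha> - \<beta> :: 'a \<Rightarrow>\<^sub>0 nat) \<subseteq> Poly_Mapping.keys \<alpha>"
  by (auto simp: in_keys_iff lookup_minus)

lemma expvecs_minus: "\<alpha> \<in> expvecs d \<Longrightarrow> \<alpha> - \<beta> \<in> expvecs d"
  using keys_minus_nat[of \<alpha> \<beta>] by (auto simp: expvecs_def)

lemma single_in_expvecs: "j \<in> {1..d} \<Longrightarrow> Poly_Mapping.single j k \<in> expvecs d"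
  by (auto simp: expvecs_def)

text \<open>A power of each variable in \<open>I\<close> bounds every coordinate on the complement,
  which gives finiteness; closure of \<open>I\<close> under multiples makes the complement closed
  downward.\<close>

lemma is_partition_phi:
  fixes I :: "((nat \<Rightarrow>\<^sub>0 nat) \<Rightarrow>\<^sub>0 'k::field) set"
  assumes I: "artinian_monomial_ideal d I"
  shows "is_partition d (phi d I)"
proof -
  have id: "ideal I (mpoly_ring d)"
    using I ideal_monomial_ideal by (auto simp: artinian_monomial_ideal_def)
  obtain k where k: "monomial (Poly_Mapping.single j (k j)) \<in> I" if "j \<in> {1..d}" for j
    using artinian_contains_power[OF I] by metis
  have "phi d I \<subseteq> {\<alpha> \<in> expvecs d. \<forall>j\<in>{1..d}. Poly_Mapping.lookup \<alpha> j < k j}"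
  proof (rule subsetI, rule CollectI, intro conjI ballI)
    fix \<alpha> assume \<alpha>: "\<alpha> \<in> phi d I"
    show "\<alpha> \<in> expvecs d" using \<alpha> by (simp add: phi_def)
    fix j assume j: "j \<in> {1..d}"
    show "Poly_Mapping.lookup \<alpha> j < k j"
    proof (rule ccontr)
      assume "\<not> ?thesis"
      then have "Poly_Mapping.single j (k j) + (\<alpha> - Poly_Mapping.single j (k j)) = \<alpha>"
        using minus_single_add_single[of "k j" \<alpha> j] by (simp add: add.commute)
      then have "monomial \<alpha> \<in> I"
        using monomial_ideal_upward[OF id k[OF j], of "\<alpha> - Poly_Mapping.single j (k j)"]
          expvecs_minus \<open>\<alpha> \<in> expvecs d\<close> by metis
      then show False using \<alpha> by (simp add: phi_def)
    qed
  qed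
  then have "finite (phi d I)"
    using finite_bounded_expvecs finite_subset by blast
  moreover have "\<alpha> - unit_vec j \<in> phi d I"
    if "\<alpha> \<in> phi d I" "j \<in> {1..d}" "Poly_Mapping.lookup \<alpha> j > 0" for \<alpha> j
    using that minus_single_add_single[of 1 \<alpha> j]
      monomial_ideal_upward[OF id, of "\<alpha> - unit_vec j" "unit_vec j"]
    by (auto simp: phi_def unit_vec_def expvecs_minus single_in_expvecs)
  ultimately show ?thesis
    by (auto simp: is_partition_def phi_def)
qed

section \<open>Hook vectors and exchange moves\<close>

lemma partition_downward:
  assumes P: "is_partition d P" and j: "j \<in> {1..d}"
  shows "\<alpha> + Poly_Mapping.single j (h + k) \<in> P \<Longrightarrow> \<alpha> + Poly_Mapping.single j h \<in> P"
proof (induction k)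
  case (Suc k)
  have "\<alpha> + Poly_Mapping.single j (h + Suc k) - unit_vec j = \<alpha> + Poly_Mapping.single j (h + k)"
    by (rule poly_mapping_eqI)
      (auto simp: lookup_add lookup_minus lookup_single when_def unit_vec_def)
  moreover have "Poly_Mapping.lookup (\<alpha> + Poly_Mapping.single j (h + Suc k)) j > 0"
    by (simp add: lookup_add)
  ultimately have "\<alpha> + Poly_Mapping.single j (h + k) \<in> P"
    using P Suc.prems j by (metis is_partition_def)
  then show ?case by (rule Suc.IH)
qed simp

text \<open>Arms have no gaps, since a partition is closed downward. This trades the maximum in
  \<open>arm_length\<close> for plain membership of cells.\<close>

lemma le_arm_length_iff:
  assumes P: "is_partition d P" and j: "j \<in> {1..d}" and \<alpha>: "\<alpha> \<in> P"
  shows "h \<le> arm_length P \<alpha> j \<longleftrightarrow> \<alpha> + Poly_Mapping.single j h \<in> P"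
proof -
  \<comment> \<open>A crude bound on all \<open>j\<close>th coordinates in the finite set
    \<open>P\<close>; with the value 0 as a candidate, it ensures that \<open>GREATEST\<close> is
    attained.\<close>
  define N where "N = (\<Sum>\<beta>\<in>P. Poly_Mapping.lookup \<beta> j)"
  have bound: "h \<le> N" if "\<alpha> + Poly_Mapping.single j h \<in> P" for h
  proof -
    have "Poly_Mapping.lookup (\<alpha> + Poly_Mapping.single j h) j \<le> N"
      unfolding N_def using P that by (intro member_le_sum) (auto simp: is_partition_def)
    then show ?thesis by (simp add: lookup_add)
  qed
  have "\<alpha> + Poly_Mapping.single j 0 \<in> P" using \<alpha> by simp
  then have arm: "\<alpha> + Poly_Mapping.single j (arm_length P \<alpha> j) \<in> P"
    unfolding arm_length_def
    using GreatestI_nat[where P = "\<lambda>h. \<alpha> + Poly_Mapping.single j h \<in> P" and b = N] bound by blast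
  show ?thesis
  proof
    assume "h \<le> arm_length P \<alpha> j"
    then show "\<alpha> + Poly_Mapping.single j h \<in> P"
      using partition_downward[OF P j] arm by (metis le_add_diff_inverse)
  next
    assume "\<alpha> + Poly_Mapping.single j h \<in> P"
    then show "h \<le> arm_length P \<alpha> j"
      unfolding arm_length_def
      using Greatest_le_nat[where P = "\<lambda>h. \<alpha> + Poly_Mapping.single j h \<in> P" and b = N] bound by blast
  qed
qed

text \<open>Strong stability seen from the complement: the moves run in the opposite direction, from
  a smaller index to a larger one.\<close>

definition exchange_closed :: "nat \<Rightarrow> (nat \<Rightarrow>\<^sub>0 nat) set \<Rightarrow> bool" where
  "exchange_closed d P \<longleftrightarrow>
     (\<forall>\<alpha>\<in>P. \<forall>i\<in>{1..d}. \<forall>j\<in>{1..d}. i < j \<and> Poly_Mapping.lookup \<alpha> i > 0 \<longrightarrow>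
        \<alpha> - unit_vec i + unit_vec j \<in> P)"

lemma sorted_wrt_upt_iff:
  "sorted_wrt Q [m..<n] \<longleftrightarrow> (\<forall>i j. m \<le> i \<and> i < j \<and> j < n \<longrightarrow> Q i j)"
proof (induction n)
  case (Suc n)
  have "(\<forall>i j. m \<le> i \<and> i < j \<and> j < Suc n \<longrightarrow> Q i j) \<longleftrightarrow>
    (\<forall>i j. m \<le> i \<and> i < j \<and> j < n \<longrightarrow> Q i j) \<and> (\<forall>i. m \<le> i \<and> i < n \<longrightarrow> Q i n)"
    unfolding less_Suc_eq by metis
  then show ?case
    using Suc by (auto simp: sorted_wrt_append)
qed simp

lemma sorted_hook_vector_iff:
  "sorted (hook_vector d P \<alpha>) \<longleftrightarrow>
     (\<forall>i\<in>{1..d}. \<forall>j\<in>{1..d}. i < j \<longrightarrow> arm_length P \<alpha> i \<le> arm_length P \<alpha> j)"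
  unfolding hook_vector_def sorted_map sorted_wrt_upt_iff by (force simp: less_Suc_eq_le)

text \<open>Each exchange turns one unit in direction \<open>i\<close> into one in direction
  \<open>j\<close>. The parameter \<open>k\<close> counts the units already moved and has to vary in
  the induction.\<close>

lemma exchange_closed_move:
  assumes P: "exchange_closed d P" and ij: "i \<in> {1..d}" "j \<in> {1..d}" "i < j"
  shows "\<alpha> + Poly_Mapping.single i h + Poly_Mapping.single j k \<in> P \<Longrightarrow>
    \<alpha> + Poly_Mapping.single j (h + k) \<in> P"
proof (induction h arbitrary: k)
  case (Suc h)
  let ?\<beta> = "\<alpha> + Poly_Mapping.single i (Suc h) + Poly_Mapping.single j k"
  have "Poly_Mapping.lookup ?\<beta> i > 0" by (simp add: lookup_add)
  then have "?\<beta> - unit_vec i + unit_vec j \<in> P"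
    using P Suc.prems ij unfolding exchange_closed_def by blast
  moreover have "?\<beta> - unit_vec i + unit_vec j
      = \<alpha> + Poly_Mapping.single i h + Poly_Mapping.single j (Suc k)"
    using \<open>i < j\<close> by (intro poly_mapping_eqI)
      (auto simp: lookup_add lookup_minus lookup_single when_def unit_vec_def)
  ultimately show ?case using Suc.IH[of "Suc k"] by simp
qed simp

lemma sorted_hooks_iff_exchange_closed:
  assumes P: "is_partition d P"
  shows "(\<forall>\<alpha>\<in>P. sorted (hook_vector d P \<alpha>)) \<longleftrightarrow> exchange_closed d P"
proof
  assume hooks: "\<forall>\<alpha>\<in>P. sorted (hook_vector d P \<alpha>)"
  show "exchange_closed d P"
    unfolding exchange_closed_def
  proof (intro ballI impI, elim conjE)
    fix \<alpha> i j assume \<alpha>: "\<alpha> \<in> P" and ij: "i \<in> {1..d}" "j \<in> {1..d}" "i < j"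
      and pos: "0 < Poly_Mapping.lookup \<alpha> i"
    \<comment> \<open>Seen from this cell, \<open>\<alpha>\<close> lies one step in direction
      \<open>i\<close> and the desired cell one step in direction \<open>j\<close>.\<close>
    let ?\<beta> = "\<alpha> - unit_vec i"
    have \<beta>: "?\<beta> \<in> P" using P \<alpha> ij pos by (auto simp: is_partition_def)
    have "?\<beta> + Poly_Mapping.single i 1 \<in> P"
      using \<alpha> pos minus_single_add_single[of 1 \<alpha> i] by (simp add: unit_vec_def)
    then have "1 \<le> arm_length P ?\<beta> i"
      using le_arm_length_iff[OF P ij(1) \<beta>] by blast
    also have "\<dots> \<le> arm_length P ?\<beta> j"
      using hooks \<beta> ij unfolding sorted_hook_vector_iff by blast
    finally show "?\<beta> + unit_vec j \<in> P"
      using le_arm_length_iff[OF P ij(2) \<beta>] by (simp add: unit_vec_def)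
  qed
next
  assume ex: "exchange_closed d P"
  show "\<forall>\<alpha>\<in>P. sorted (hook_vector d P \<alpha>)"
    unfolding sorted_hook_vector_iff
  proof (intro ballI impI)
    fix \<alpha> i j assume \<alpha>: "\<alpha> \<in> P" and ij: "i \<in> {1..d}" "j \<in> {1..d}" "i < j"
    have "\<alpha> + Poly_Mapping.single i (arm_length P \<alpha> i) \<in> P"
      using le_arm_length_iff[OF P ij(1) \<alpha>] by blast
    \<comment> \<open>The whole \<open>i\<close>th arm is moved to direction \<open>j\<close>,
      starting with no unit moved.\<close>
    then have "\<alpha> + Poly_Mapping.single j (arm_length P \<alpha> i) \<in> P"
      using exchange_closed_move[OF ex ij, of \<alpha> _ 0] by simp
    then show "arm_length P \<alpha> i \<le> arm_length P \<alpha> j"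
      using le_arm_length_iff[OF P ij(2) \<alpha>] by blast
  qed
qed

lemma exchange_inverse:
  assumes "i \<noteq> j" "Poly_Mapping.lookup \<alpha> i > 0"
  shows "\<alpha> - unit_vec i + unit_vec j - unit_vec j + unit_vec i = \<alpha>"
    and "Poly_Mapping.lookup (\<alpha> - unit_vec i + unit_vec j) j > 0"
  using minus_single_add_single[of 1 \<alpha> i] assms by (auto simp: unit_vec_def lookup_add)

text \<open>Each direction is a contrapositive: an exchange is undone by the reverse exchange, so a
  move from the complement into \<open>I\<close> would yield a move from \<open>I\<close> into the
  complement, and vice versa.\<close>

lemma strongly_stable_iff_exchange_closed:
  "strongly_stable d I \<longleftrightarrow> exchange_closed d (phi d I)"
proof -
  \<comment> \<open>Exchanges stay among the exponent vectors, so there lying outside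
    \<open>phi d I\<close> means that the monomial lies in \<open>I\<close>.\<close>
  have exp: "\<alpha> - unit_vec i + unit_vec j \<in> expvecs d"
    if "\<alpha> \<in> expvecs d" "j \<in> {1..d}" for \<alpha> i j
    using that by (simp add: expvecs_add expvecs_minus single_in_expvecs unit_vec_def)
  show ?thesis
  proof
    assume st: "strongly_stable d I"
    show "exchange_closed d (phi d I)"
      unfolding exchange_closed_def
    proof (intro ballI impI, elim conjE)
      fix \<alpha> i j assume \<alpha>: "\<alpha> \<in> phi d I" and ij: "i \<in> {1..d}" "j \<in> {1..d}" "i < j"
        and pos: "0 < Poly_Mapping.lookup \<alpha> i"
      then show "\<alpha> - unit_vec i + unit_vec j \<in> phi d I"
        using st exp[of \<alpha> j i] exchange_inverse[of i j \<alpha>]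
        unfolding strongly_stable_def phi_def by fastforce
    qed
  next
    assume ex: "exchange_closed d (phi d I)"
    show "strongly_stable d I"
      unfolding strongly_stable_def
    proof (intro ballI impI, elim conjE)
      fix \<alpha> i j assume \<alpha>: "\<alpha> \<in> expvecs d" "monomial \<alpha> \<in> I"
        and ij: "i \<in> {1..d}" "j \<in> {1..d}" "i < j" and pos: "0 < Poly_Mapping.lookup \<alpha> j"
      then show "monomial (\<alpha> - unit_vec j + unit_vec i) \<in> I"
        using ex exp[of \<alpha> i j] exchange_inverse[of j i \<alpha>]
        unfolding exchange_closed_def phi_def by fastforce
    qed
  qed
qed

theorem proposition4p5:
  fixes d n :: nat and I :: "((nat \<Rightarrow>\<^sub>0 nat) \<Rightarrow>\<^sub>0 'k::field_char_0) set"
  assumes "d > 0" and "n > 0" and "I \<in> artinian_class d n"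
  shows "strongly_stable d I \<longleftrightarrow> strongly_stable_partition d (phi d I)"
proof -
  \<comment> \<open>With the partition property secured, only the hook condition remains to be
    compared with strong stability.\<close>
  have "is_partition d (phi d I)"
    using assms(3) is_partition_phi by (auto simp: artinian_class_def)
  then show ?thesis
    using sorted_hooks_iff_exchange_closed strongly_stable_iff_exchange_closed
    by (auto simp: strongly_stable_partition_def)
qed

end
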